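(* Let $f(x)=e^{-x}$. If $\mathbf x=\{0=x_0<x_1<x_2<\dots\}$ is an optimal search plan for the one-sided search problem with tail distribution function $f$, then its starting point $(y,z)=(x_1,x_1)$ lies on the separatrix $\mathcal S$. In other words, the minimum of the cost can be achieved only at a point of intersection of the separatrix with the line of initial conditions $\{(t,t):t>0\}$.
   Context: A plan is a strictly increasing sequence $0=x_0<x_1<x_2<\dots$ with $x_k\to\infty$; its cost is $E(\mathbf x)=\sum_{k=1}^\infty x_k f(x_{k-1})$, where $f(x)=\mathbb P(\mathbf H>x)=e^{-x}$. A plan is optimal if it has minimal cost among all plans. The variational recursion is $x_{n+1}=-f(x_{n-1})/f'(x_n)=e^{x_n-x_{n-1}}$, $n\ge 1$. In the coordinates $(y,z)=(x_{k+1},x_{k+1}-x_k)$ it is the map $\mathbf R(y,z)=(e^z,e^z-y)$, and the initial data $x_0=0,\ x_1=t$ is the point $(t,t)$. The phase space is $\mathcal P=\{(y,z): y\ge 0,\ y-z\ge 0\}$. The monotone region $\mathcal M_\infty\subset\mathcal P$ is the set of points $p\in\mathcal P$ such that the $y$-coordinates of $p,\mathbf R(p),\mathbf R^2(p),\dots$ form a strictly increasing sequence. The separatrix $\mathcal S$ is the boundary of $\mathcal M_\infty$ relative to $\mathcal P$. *)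

theory Defs
  imports "HOL-Analysis.Analysis"
begin

definition search_plan :: "(nat \<Rightarrow> real) \<Rightarrow> bool" where
  "search_plan x \<longleftrightarrow> x 0 = 0 \<and> strict_mono x \<and> filterlim x at_top sequentially"

(* The cost may be infinite, hence the values in ennreal; the terms are nonnegative
   for a plan and a tail distribution function, so no truncation takes place. *)
definition search_cost :: "(real \<Rightarrow> real) \<Rightarrow> (nat \<Rightarrow> real) \<Rightarrow> ennreal" where
  "search_cost f x = (\<Sum>k. ennreal (x (Suc k) * f (x k)))"

definition optimal_plan :: "(real \<Rightarrow> real) \<Rightarrow> (nat \<Rightarrow> real) \<Rightarrow> bool" where
  "optimal_plan f x \<longleftrightarrow>
     search_plan x \<and> (\<forall>x'. search_plan x' \<longrightarrow> search_cost f x \<le> search_cost f x')"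

(* The variational recursion x (n+1) = - f (x (n-1)) / f' (x n) for f x = exp (- x),
   in the coordinates (y, z) = (x (k+1), x (k+1) - x k). *)
definition R_map :: "real \<times> real \<Rightarrow> real \<times> real" where
  "R_map = (\<lambda>(y, z). (exp z, exp z - y))"

definition phase_space :: "(real \<times> real) set" where
  "phase_space = {(y, z). y \<ge> 0 \<and> y - z \<ge> 0}"

definition monotone_region :: "(real \<times> real) set" where
  "monotone_region = {p \<in> phase_space. strict_mono (\<lambda>n. fst ((R_map ^^ n) p))}"

definition separatrix :: "(real \<times> real) set" where
  "separatrix = (top_of_set phase_space) frontier_of monotone_region"

end

theory Submission
  imports Defs
begin

text \<open>
  An optimal plan is a critical point of the cost in each coordinate, so it satisfies
  \<open>x (n + 2) = exp (x (n + 1) - x n)\<close>; it is then the orbit of \<open>(x 1, x 1)\<close> under the map, and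
  since it increases, \<open>(x 1, x 1)\<close> belongs to the monotone region. It remains to see that this
  point is not interior. Two growth rates collide.

  On the one hand, an optimal plan grows slowly. From \<open>x N\<close> on, one may search in steps of
  length 2, at a cost of at most \<open>(3/2 * x N + 9/2) * exp (- x N)\<close>; by optimality this bounds the
  single term \<open>x (N + 1) * exp (- x N)\<close>, whence \<open>x (N + 1) \<le> 3/2 * x N + 9/2\<close>
  (\<open>optimal_plan_growth\<close>) and \<open>x n = O((3/2)^n)\<close>.

  On the other hand, monotone orbits diverge fast from each other. If \<open>x\<close> and \<open>x'\<close> solve the
  recursion, then by convexity of \<open>exp\<close> the difference \<open>d = x - x'\<close> satisfies
  \<open>d (n + 2) \<ge> x' (n + 2) * (d (n + 1) - d n)\<close>. Where \<open>x' \<ge> 4\<close>, the relation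
  \<open>d (n + 1) \<ge> 2 * d n\<close> thus reproduces itself (\<open>orbit_difference_doubles\<close>). Were \<open>(t, t)\<close> interior
  with \<open>t = x 1\<close>, the points \<open>(t, t - a)\<close> with small \<open>a > 0\<close> would lie in the monotone region as
  well. This perturbation fixes the first coordinate, so the differences \<open>d 1 = 0 < d 2\<close> start out
  in the expanding direction, whatever \<open>t\<close> is. Hence \<open>x n \<ge> d n \<ge> 2 ^ (n - 2) * d 2\<close>,
  contradicting the first bound.
\<close>

section \<open>Optimal plans grow at most geometrically\<close>

lemma search_cost_split:
  "search_cost f x = (\<Sum>k. ennreal (x (Suc (k + n)) * f (x (k + n))))
     + (\<Sum>k<n. ennreal (x (Suc k) * f (x k)))"
  unfolding search_cost_def
  by (subst suminf_offset[of _ n]) auto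

lemma search_plan_nonneg: "search_plan x \<Longrightarrow> 0 \<le> x n"
  unfolding search_plan_def by (metis le0 strict_mono_less_eq)

text \<open>
  With \<open>q = exp (-2) \<le> 1/3\<close> the exact value is
  \<open>exp (- a) * (a / (1 - q) + 2 / (1 - q)^2)\<close>. All that matters later is that the
  coefficient \<open>3/2\<close> is smaller than the factor 2 by which orbits separate.
\<close>
lemma arithmetic_tail_cost:
  fixes a :: real
  assumes "a \<ge> 0"
  shows "(\<Sum>k. ennreal ((a + 2 * real (Suc k)) * exp (- (a + 2 * real k))))
           \<le> ennreal ((3/2 * a + 9/2) * exp (- a))"
proof -
  define q :: real where "q = exp (-2)"
  have "3 \<le> exp (2::real)" using exp_ge_add_one_self[of 2] by simp
  then have q: "0 < q" "q \<le> 1/3"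
    by (auto simp: q_def exp_minus field_simps)
  have qk: "exp (- (a + 2 * real k)) = exp (- a) * q ^ k" for k
    by (simp add: q_def exp_of_nat_mult[symmetric] exp_add[symmetric])
  have "(\<lambda>k. exp (- a) * (a * q ^ k + 2 * (of_nat (Suc k) * q ^ k)))
          sums (exp (- a) * (a * (1 / (1 - q)) + 2 * (1 / (1 - q)^2)))"
    using q by (intro sums_mult sums_add geometric_sums geometric_deriv_sums) auto
  then have sums: "(\<lambda>k. (a + 2 * real (Suc k)) * exp (- (a + 2 * real k)))
          sums (exp (- a) * (a * (1 / (1 - q)) + 2 * (1 / (1 - q)^2)))"
    unfolding qk by (simp add: algebra_simps)
  have r: "1 / (1 - q) \<le> 3/2" using q by (simp add: field_simps)
  then have "(1 / (1 - q))^2 \<le> (3/2)^2" using q by (intro power_mono) auto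
  then have "1 / (1 - q)^2 \<le> 9/4" by (simp add: power_divide)
  then have "exp (- a) * (a * (1 / (1 - q)) + 2 * (1 / (1 - q)^2)) \<le> exp (- a) * (a * (3/2) + 2 * (9/4))"
    using assms r by (intro mult_left_mono add_mono) auto
  moreover have "(\<Sum>k. ennreal ((a + 2 * real (Suc k)) * exp (- (a + 2 * real k))))
      = ennreal (exp (- a) * (a * (1 / (1 - q)) + 2 * (1 / (1 - q)^2)))"
    using assms sums by (intro suminf_ennreal_eq) auto
  ultimately show ?thesis
    by (auto intro!: ennreal_leI simp: algebra_simps)
qed

lemma optimal_plan_growth:
  assumes opt: "optimal_plan (\<lambda>u. exp (- u)) x"
  shows "x (Suc N) \<le> 3/2 * x N + 9/2"
proof -
  have plan: "search_plan x" using opt by (simp add: optimal_plan_def)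
  note pos = search_plan_nonneg[OF plan]
  define x' where "x' = (\<lambda>k. if k \<le> N then x k else x N + 2 * real (k - N))"
  have tail': "x' (k + N) = x N + 2 * real k" for k
    by (auto simp: x'_def)
  have "search_plan x'"
    unfolding search_plan_def
  proof (intro conjI)
    show "x' 0 = 0" using plan by (simp add: x'_def search_plan_def)
    show "strict_mono x'"
      unfolding strict_mono_Suc_iff
    proof
      fix k
      have "x k < x (Suc k)" using plan by (simp add: search_plan_def strict_mono_Suc_iff)
      show "x' k < x' (Suc k)"
      proof (cases "k < N")
        case True
        then show ?thesis using \<open>x k < x (Suc k)\<close> by (simp add: x'_def)
      next
        case False
        then obtain j where "k = j + N" by (metis add.commute le_iff_add not_less)
        then show ?thesis using tail'[of j] tail'[of "Suc j"] by simp
      qed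
    qed
    have "filterlim (\<lambda>k. (x N - 2 * real N) + 2 * real k) at_top sequentially"
      by (intro filterlim_tendsto_add_at_top[OF tendsto_const]
          filterlim_tendsto_pos_mult_at_top[OF tendsto_const] filterlim_real_sequentially) auto
    moreover have "eventually (\<lambda>k. (x N - 2 * real N) + 2 * real k \<le> x' k) sequentially"
      using eventually_gt_at_top[of N] by eventually_elim (auto simp: x'_def of_nat_diff)
    ultimately show "filterlim x' at_top sequentially"
      by (rule filterlim_at_top_mono)
  qed
  then have "search_cost (\<lambda>u. exp (- u)) x \<le> search_cost (\<lambda>u. exp (- u)) x'"
    using opt by (simp add: optimal_plan_def)
  moreover have "(\<Sum>k<N. ennreal (x' (Suc k) * exp (- x' k))) = (\<Sum>k<N. ennreal (x (Suc k) * exp (- x k)))"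
    by (intro sum.cong) (auto simp: x'_def)
  ultimately have "(\<Sum>k. ennreal (x (Suc (k + N)) * exp (- x (k + N))))
      \<le> (\<Sum>k. ennreal (x' (Suc (k + N)) * exp (- x' (k + N))))"
    by (simp add: search_cost_split[of _ _ N] add.commute[of _ "sum _ _"] ennreal_add_left_cancel_le)
  also have "\<dots> = (\<Sum>k. ennreal ((x N + 2 * real (Suc k)) * exp (- (x N + 2 * real k))))"
    using tail'[of "Suc _"] by (simp add: tail')
  also have "\<dots> \<le> ennreal ((3/2 * x N + 9/2) * exp (- x N))"
    by (rule arithmetic_tail_cost[OF pos])
  finally have "(\<Sum>k. ennreal (x (Suc (k + N)) * exp (- x (k + N)))) \<le> \<dots>" .
  moreover have "ennreal (x (Suc N) * exp (- x N)) \<le> (\<Sum>k. ennreal (x (Suc (k + N)) * exp (- x (k + N))))"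
    using sum_le_suminf[of "\<lambda>k. ennreal (x (Suc (k + N)) * exp (- x (k + N)))" "{0}"] by simp
  ultimately have "ennreal (x (Suc N) * exp (- x N)) \<le> ennreal ((3/2 * x N + 9/2) * exp (- x N))"
    by (rule order_trans[rotated])
  then show ?thesis
    using pos[of N] by (simp add: ennreal_le_iff)
qed

lemma optimal_plan_geometric_bound:
  assumes "optimal_plan (\<lambda>u. exp (- u)) x"
  shows "x n + 9 \<le> 9 * (3/2) ^ n"
proof (induction n)
  case 0
  then show ?case using assms by (simp add: optimal_plan_def search_plan_def)
next
  case (Suc n)
  then show ?case using optimal_plan_growth[OF assms, of n] by simp
qed

section \<open>Optimal plans satisfy the variational recursion\<close>

lemma optimal_plan_finite_cost:
  assumes "optimal_plan (\<lambda>u. exp (- u)) x"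
  shows "search_cost (\<lambda>u. exp (- u)) x < top"
proof -
  define x' where "x' = (\<lambda>k. 2 * real k)"
  have "filterlim x' at_top sequentially"
    unfolding x'_def
    by (intro filterlim_tendsto_pos_mult_at_top[OF tendsto_const] filterlim_real_sequentially) auto
  then have "search_plan x'"
    by (auto simp: search_plan_def x'_def strict_mono_def)
  then have "search_cost (\<lambda>u. exp (- u)) x \<le> search_cost (\<lambda>u. exp (- u)) x'"
    using assms by (simp add: optimal_plan_def)
  also have "\<dots> \<le> ennreal ((3/2 * 0 + 9/2) * exp (- 0))"
    using arithmetic_tail_cost[of 0] unfolding search_cost_def x'_def by (simp only: add_0)
  also have "\<dots> < top" by simp
  finally show ?thesis .
qed

text \<open>
  Moving the single point \<open>x (n + 1)\<close> changes only the two cost terms that contain it, so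
  \<open>u * exp (- x n) + x (n + 2) * exp (- u)\<close> has a local minimum at \<open>u = x (n + 1)\<close>.
\<close>
lemma optimal_plan_recursion:
  assumes opt: "optimal_plan (\<lambda>u. exp (- u)) x"
  shows "x (Suc (Suc n)) = exp (x (Suc n) - x n)"
proof -
  have plan: "search_plan x" using opt by (simp add: optimal_plan_def)
  note pos = search_plan_nonneg[OF plan]
  have mono: "x k < x (Suc k)" for k
    using plan by (simp add: search_plan_def strict_mono_Suc_iff)
  define g where "g = (\<lambda>u. u * exp (- x n) + x (Suc (Suc n)) * exp (- u))"
  have min: "g (x (Suc n)) \<le> g u" if u: "x n < u" "u < x (Suc (Suc n))" for u
  proof -
    define x' where "x' = x(Suc n := u)"
    have "search_plan x'"
      unfolding search_plan_def
    proof (intro conjI)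
      show "x' 0 = 0" using plan by (simp add: x'_def search_plan_def)
      show "strict_mono x'"
        using mono u by (auto simp: strict_mono_Suc_iff x'_def)
      have "eventually (\<lambda>k. x k = x' k) sequentially"
        using eventually_gt_at_top[of "Suc n"] by eventually_elim (auto simp: x'_def)
      then show "filterlim x' at_top sequentially"
        using plan unfolding search_plan_def by (metis filterlim_cong)
    qed
    then have le: "search_cost (\<lambda>u. exp (- u)) x \<le> search_cost (\<lambda>u. exp (- u)) x'"
      using opt by (simp add: optimal_plan_def)
    note pos' = search_plan_nonneg[OF \<open>search_plan x'\<close>]
    let ?m = "Suc (Suc n)"
    let ?T = "\<Sum>k. ennreal (x (Suc (k + ?m)) * exp (- x (k + ?m)))"
    have "?T \<le> search_cost (\<lambda>u. exp (- u)) x"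
      by (subst search_cost_split[of _ _ ?m]) simp
    then have fin: "?T \<noteq> \<infinity>"
      using optimal_plan_finite_cost[OF opt] by auto
    have "(\<Sum>k. ennreal (x' (Suc (k + ?m)) * exp (- x' (k + ?m)))) = ?T"
      by (simp add: x'_def)
    with le fin have "(\<Sum>k<?m. ennreal (x (Suc k) * exp (- x k))) \<le> (\<Sum>k<?m. ennreal (x' (Suc k) * exp (- x' k)))"
      unfolding search_cost_split[of _ _ ?m] by (simp only: ennreal_add_left_cancel_le) simp
    then have "(\<Sum>k<?m. x (Suc k) * exp (- x k)) \<le> (\<Sum>k<?m. x' (Suc k) * exp (- x' k))"
      using pos pos' by (simp only: sum_ennreal mult_nonneg_nonneg exp_ge_zero ennreal_le_iff sum_nonneg)
    moreover have "(\<Sum>k<n. x' (Suc k) * exp (- x' k)) = (\<Sum>k<n. x (Suc k) * exp (- x k))"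
      by (intro sum.cong) (auto simp: x'_def)
    ultimately show ?thesis
      by (simp add: g_def x'_def)
  qed
  define \<delta> where "\<delta> = min (x (Suc n) - x n) (x (Suc (Suc n)) - x (Suc n))"
  have "(g has_real_derivative (exp (- x n) - x (Suc (Suc n)) * exp (- x (Suc n)))) (at (x (Suc n)))"
    unfolding g_def by (auto intro!: derivative_eq_intros)
  moreover have "0 < \<delta>" using mono by (simp add: \<delta>_def)
  moreover have "\<forall>u. \<bar>x (Suc n) - u\<bar> < \<delta> \<longrightarrow> g (x (Suc n)) \<le> g u"
    by (auto intro!: min simp: \<delta>_def)
  ultimately have "exp (- x n) - x (Suc (Suc n)) * exp (- x (Suc n)) = 0"
    by (rule DERIV_local_min)
  then show ?thesis
    by (simp add: exp_diff exp_minus field_simps)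
qed

section \<open>Orbits of the map and solutions of the recursion\<close>

lemma R_map_orbit:
  assumes "\<And>n. x (Suc (Suc n)) = exp (x (Suc n) - x n)"
  shows "(R_map ^^ n) (x 1, x 1 - x 0) = (x (Suc n), x (Suc n) - x n)"
  by (induction n) (simp_all add: R_map_def assms)

lemma R_map_orbit_exists:
  obtains x where "x 0 = y - z" "x (Suc 0) = y"
    "\<And>n. x (Suc (Suc n)) = exp (x (Suc n) - x n)"
    "\<And>n. fst ((R_map ^^ n) (y, z)) = x (Suc n)"
proof
  define x where "x = (\<lambda>n. fst ((R_map ^^ n) (y, z)) - snd ((R_map ^^ n) (y, z)))"
  have step: "x (Suc n) = fst ((R_map ^^ n) (y, z))" for n
    by (simp add: x_def R_map_def case_prod_beta)
  show "x 0 = y - z" "x (Suc 0) = y" by (simp_all add: x_def R_map_def)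
  show "fst ((R_map ^^ n) (y, z)) = x (Suc n)" for n by (simp add: step)
  have "x (Suc n) - x n = snd ((R_map ^^ n) (y, z))" for n
    unfolding step by (simp add: x_def)
  then show "x (Suc (Suc n)) = exp (x (Suc n) - x n)" for n
    by (simp add: step[of "Suc n"] R_map_def case_prod_beta)
qed

section \<open>Divergence of monotone orbits\<close>

text \<open>The tangent line of the exponential at \<open>x' (n + 1) - x' n\<close>, where the slope is \<open>x' (n + 2)\<close>.\<close>
lemma orbit_difference_step:
  fixes x x' :: "nat \<Rightarrow> real"
  assumes "x (Suc (Suc n)) = exp (x (Suc n) - x n)" "x' (Suc (Suc n)) = exp (x' (Suc n) - x' n)"
  shows "x' (Suc (Suc n)) * ((x (Suc n) - x' (Suc n)) - (x n - x' n))
           \<le> x (Suc (Suc n)) - x' (Suc (Suc n))"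
proof -
  define z z' where "z = x (Suc n) - x n" and "z' = x' (Suc n) - x' n"
  have "exp z' * (1 + (z - z')) \<le> exp z' * exp (z - z')"
    by (intro mult_left_mono exp_ge_add_one_self) auto
  then have "exp z' * (z - z') \<le> exp z - exp z'"
    by (simp add: exp_add[symmetric] algebra_simps)
  then show ?thesis
    unfolding assms z_def z'_def by (simp add: algebra_simps)
qed

lemma orbit_difference_doubles:
  fixes x x' :: "nat \<Rightarrow> real"
  defines "d \<equiv> \<lambda>n. x n - x' n"
  assumes rec: "\<And>n. x (Suc (Suc n)) = exp (x (Suc n) - x n)"
      "\<And>n. x' (Suc (Suc n)) = exp (x' (Suc n) - x' n)"
    and large: "\<And>n. n \<ge> m \<Longrightarrow> x' (Suc (Suc n)) \<ge> 4"
    and start: "0 \<le> d m" "2 * d m \<le> d (Suc m)"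
  shows "2 ^ n * d m \<le> d (m + n)"
proof -
  have "0 \<le> d (m + n) \<and> 2 ^ n * d m \<le> d (m + n) \<and> 2 * d (m + n) \<le> d (Suc (m + n))"
  proof (induction n)
    case 0
    then show ?case using start by simp
  next
    case (Suc n)
    then have "4 * (d (Suc (m + n)) - d (m + n)) \<le> x' (Suc (Suc (m + n))) * (d (Suc (m + n)) - d (m + n))"
      using large[of "m + n"] by (intro mult_right_mono) auto
    also have "\<dots> \<le> d (Suc (Suc (m + n)))"
      unfolding d_def by (rule orbit_difference_step[of x "m + n" x', OF rec])
    finally show ?case using Suc by auto
  qed
  then show ?thesis by blast
qed

text \<open>
  With \<open>u = exp t\<close> the left-hand side is the increment \<open>x 3 - x 2\<close> of the orbit of \<open>(t, t)\<close>. Its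
  minimum over \<open>t\<close> is about 1.49, against \<open>ln 4 \<approx> 1.386\<close>. The fourth-order Taylor polynomial
  of \<open>exp\<close> reduces the claim to the positivity of a quartic in \<open>u\<close> with its minimum near 1.63;
  24 times this quartic is \<open>(u - 1.63)^2 * (u^2 + 7.26 * u + 9.0107)\<close> plus a linear function
  that is positive for \<open>u > 0\<close>.
\<close>
lemma third_increment_gt_ln_4:
  fixes u :: real
  assumes "u > 0"
  shows "exp u / u - u > ln 4"
proof -
  obtain s where "exp u = (\<Sum>m<5. u ^ m / fact m) + exp s / fact 5 * u ^ 5"
    using Maclaurin_exp_le[of u 5] by blast
  moreover have "0 \<le> exp s / fact 5 * u ^ 5" using assms by simp
  moreover have "(\<Sum>m<5. u ^ m / fact m) = 1 + u + u^2/2 + u^3/6 + u^4/24"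
    by (simp add: eval_nat_numeral algebra_simps)
  ultimately have taylor: "1 + u + u^2/2 + u^3/6 + u^4/24 \<le> exp u" by linarith
  have "0 \<le> (u - 163/100)^2 * (u^2 + 726/100 * u + 90107/10000)"
    using assms by (intro mult_nonneg_nonneg) auto
  then have quartic: "u^2 + 25/18 * u < 1 + u + u^2/2 + u^3/6 + u^4/24"
    using assms by (simp add: power2_eq_square power3_eq_cube power4_eq_xxxx algebra_simps)
  have "ln (4::real) = 2 * ln 2"
    using ln_realpow[of "2::real" 2] by simp
  then have "ln (4::real) \<le> 25/18" using ln2_le_25_over_36 by simp
  also have "u^2 + 25/18 * u < exp u" using taylor quartic by simp
  then have "25/18 < exp u / u - u"
    using assms by (simp add: field_simps power2_eq_square)
  finally show ?thesis .
qed

text \<open>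
  The perturbed point is \<open>(t, t - a)\<close>, whose orbit starts with \<open>x' 0 = a\<close>, \<open>x' 1 = t\<close>: only in the
  direction \<open>a > 0\<close> does it belong to the phase space. At \<open>a = 0\<close> one has \<open>x' 3 \<ge> exp 1 > 2\<close> and
  \<open>x' 4 > 4\<close>, and both inequalities survive for small \<open>a\<close>.
\<close>
lemma nearby_monotone_point:
  assumes int: "(t, t) \<in> (top_of_set phase_space) interior_of monotone_region"
  obtains a where "a > 0" "(t, t - a) \<in> monotone_region"
    "exp (exp (t - a) - t) \<ge> 2" "exp (exp (exp (t - a) - t) - exp (t - a)) \<ge> 4"
proof -
  obtain U where U: "open U" "(t, t) \<in> U" "phase_space \<inter> U \<subseteq> monotone_region"
    using int by (auto simp: interior_of_def openin_open)
  have "(t, t) \<in> phase_space"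
    using int interior_of_subset_topspace by fastforce
  then have t: "t \<ge> 0" by (simp add: phase_space_def)
  have "((\<lambda>a. (t, t - a)) \<longlongrightarrow> (t, t - 0)) (at_right 0)"
    by (intro tendsto_intros)
  then have inU: "eventually (\<lambda>a. (t, t - a) \<in> U) (at_right 0)"
    using U by (auto dest: topological_tendstoD)
  have "((\<lambda>a. exp (exp (t - a) - t)) \<longlongrightarrow> exp (exp (t - 0) - t)) (at_right 0)"
    by (intro tendsto_intros)
  moreover have "exp (exp (t - 0) - t) > 2"
  proof -
    have "1 \<le> exp t - t" using exp_ge_add_one_self[of t] by linarith
    then have "exp 1 \<le> exp (exp t - t)" by simp
    moreover have "exp (1::real) > 2" using exp_lower_Taylor_quadratic[of "1::real"] by simp
    ultimately show ?thesis by (simp del: exp_le_cancel_iff)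
  qed
  ultimately have x3: "eventually (\<lambda>a. exp (exp (t - a) - t) > 2) (at_right 0)"
    by (rule order_tendstoD)
  have "((\<lambda>a. exp (exp (exp (t - a) - t) - exp (t - a)))
          \<longlongrightarrow> exp (exp (exp (t - 0) - t) - exp (t - 0))) (at_right 0)"
    by (intro tendsto_intros)
  moreover have "exp (exp (exp (t - 0) - t) - exp (t - 0)) > 4"
  proof -
    have "ln 4 < exp (exp t - t) - exp t"
      using third_increment_gt_ln_4[of "exp t"] by (simp add: exp_diff)
    then have "exp (ln 4) < exp (exp (exp t - t) - exp t)" by (simp only: exp_less_mono)
    then show ?thesis by simp
  qed
  ultimately have x4: "eventually (\<lambda>a. exp (exp (exp (t - a) - t) - exp (t - a)) > 4) (at_right 0)"
    by (rule order_tendstoD)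
  have "eventually (\<lambda>a. a > 0 \<and> (t, t - a) \<in> U \<and> exp (exp (t - a) - t) > 2
          \<and> exp (exp (exp (t - a) - t) - exp (t - a)) > 4) (at_right (0::real))"
    using inU x3 x4 eventually_at_right_less[of 0] by eventually_elim auto
  then obtain a where a: "a > 0" "(t, t - a) \<in> U" "exp (exp (t - a) - t) > 2"
      "exp (exp (exp (t - a) - t) - exp (t - a)) > 4"
    using eventually_happens trivial_limit_at_right_real by blast
  moreover have "(t, t - a) \<in> phase_space" using a t by (simp add: phase_space_def)
  ultimately show ?thesis using U by (intro that[of a]) auto
qed

lemma interior_orbit_grows_doubly:
  assumes rec: "\<And>n. x (Suc (Suc n)) = exp (x (Suc n) - x n)"
    and x0: "x 0 = 0"
    and int: "(x 1, x 1) \<in> (top_of_set phase_space) interior_of monotone_region"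
  obtains c where "c > 0" "\<And>n. 2 ^ n * c \<le> x (2 + n)"
proof -
  obtain a where a: "a > 0" "(x 1, x 1 - a) \<in> monotone_region"
    "exp (exp (x 1 - a) - x 1) \<ge> 2" "exp (exp (exp (x 1 - a) - x 1) - exp (x 1 - a)) \<ge> 4"
    using nearby_monotone_point[OF int] by blast
  obtain x' where x': "x' 0 = a" "x' (Suc 0) = x 1"
    and rec': "\<And>n. x' (Suc (Suc n)) = exp (x' (Suc n) - x' n)"
    and orbit: "\<And>n. fst ((R_map ^^ n) (x 1, x 1 - a)) = x' (Suc n)"
    using R_map_orbit_exists[of "x 1" "x 1 - a"] by auto
  have mono: "strict_mono (\<lambda>n. x' (Suc n))"
    using a(2) orbit by (simp add: monotone_region_def)
  have x'2: "x' 2 = exp (x 1 - a)" using rec'[of 0] x' by (simp add: numeral_2_eq_2)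
  have x'3: "x' 3 = exp (exp (x 1 - a) - x 1)"
    using rec'[of 1] x' x'2 by (simp add: numeral_2_eq_2 numeral_3_eq_3)
  have x'4: "x' 4 = exp (exp (exp (x 1 - a) - x 1) - exp (x 1 - a))"
    using rec'[of 2] x'2 x'3 by (simp add: eval_nat_numeral)
  have large: "x' (Suc (Suc n)) \<ge> 4" if "n \<ge> 2" for n
  proof -
    have "x' (Suc 3) \<le> x' (Suc (Suc n))"
      using strict_mono_less_eq[OF mono, of 3 "Suc n"] that by simp
    then show ?thesis using a(4) x'4 by (simp add: eval_nat_numeral)
  qed
  define c where "c = x 2 - x' 2"
  have "x 2 = exp (x 1)" using rec[of 0] x0 by (simp add: numeral_2_eq_2)
  then have c: "c > 0" using a(1) by (simp add: c_def x'2)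
  have "2 * c \<le> x' 3 * c" using c a(3) x'3 by simp
  also have "\<dots> \<le> x 3 - x' 3"
    using orbit_difference_step[of x 1 x', OF rec rec'] x' by (simp add: c_def eval_nat_numeral)
  finally have start: "2 * (x 2 - x' 2) \<le> x (Suc 2) - x' (Suc 2)"
    by (simp add: c_def eval_nat_numeral)
  have "2 ^ n * c \<le> x (2 + n)" for n
  proof -
    have "2 ^ n * c \<le> x (2 + n) - x' (2 + n)"
      unfolding c_def
      using large start c by (intro orbit_difference_doubles[of x x', OF rec rec']) (auto simp: c_def)
    moreover have "x' (2 + n) \<ge> 0" using rec'[of n] by simp
    ultimately show ?thesis by simp
  qed
  with c show ?thesis by (rule that)
qed

section \<open>The starting point of an optimal plan\<close>

theorem mainTheorem2:
  fixes f :: "real \<Rightarrow> real" and x :: "nat \<Rightarrow> real"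
  assumes "f = (\<lambda>u. exp (- u))"
    and "optimal_plan f x"
  shows "(x 1, x 1) \<in> separatrix \<inter> {(t, t) | t. t > 0}"
proof -
  have opt: "optimal_plan (\<lambda>u. exp (- u)) x" using assms by simp
  then have plan: "search_plan x" by (simp add: optimal_plan_def)
  then have x0: "x 0 = 0" and mono: "strict_mono x" by (auto simp: search_plan_def)
  have pos: "x 1 > 0" using strict_monoD[OF mono, of 0 1] x0 by simp
  note rec = optimal_plan_recursion[OF opt]
  have "(x 1, x 1) \<in> monotone_region"
    using R_map_orbit[of x, OF rec] x0 pos mono
    by (simp add: monotone_region_def phase_space_def strict_mono_def)
  moreover have "monotone_region \<subseteq> phase_space" by (auto simp: monotone_region_def)
  ultimately have "(x 1, x 1) \<in> (top_of_set phase_space) closure_of monotone_region"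
    using closure_of_subset[of monotone_region "top_of_set phase_space"] by auto
  moreover have "(x 1, x 1) \<notin> (top_of_set phase_space) interior_of monotone_region"
  proof
    assume "(x 1, x 1) \<in> (top_of_set phase_space) interior_of monotone_region"
    from interior_orbit_grows_doubly[OF rec x0 this]
    obtain c where c: "c > 0" "\<And>n. 2 ^ n * c \<le> x (2 + n)" by blast
    obtain n where "81/4 / c < (4/3::real) ^ n"
      using real_arch_pow[of "4/3" "81/4 / c"] by auto
    then have "81/4 < (4/3) ^ n * c" using c(1) by (simp add: field_simps)
    then have "81/4 * (3/2) ^ n < (4/3) ^ n * c * (3/2::real) ^ n"
      by (intro mult_strict_right_mono) auto
    also have "\<dots> = ((4/3) * (3/2)) ^ n * c" by (simp only: power_mult_distrib mult_ac)
    also have "\<dots> = 2 ^ n * c" by simp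
    also have "\<dots> \<le> x (2 + n)" by (rule c)
    also have "\<dots> \<le> 9 * (3/2) ^ (2 + n) - 9"
      using optimal_plan_geometric_bound[OF opt, of "2 + n"] by simp
    also have "\<dots> = 81/4 * (3/2) ^ n - 9" by (simp add: power_add power2_eq_square)
    finally show False by simp
  qed
  ultimately show ?thesis using pos by (auto simp: separatrix_def frontier_of_def)
qed

end
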